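(* For every integer $k\ge 6$ with $k\equiv 2\pmod 4$, row $k$ of the skeleton $\mathcal{L}_1$ contains no primes.
   Context: The principal skeleton is $\mathcal{L}_1=\{2^a\cdot 3^b-1: a\ge 1,\ b\ge 0\}$ ($a,b$ integers). Row $k$ of $\mathcal{L}_1$ is the set $\{2^a\cdot 3^b-1: a+b=k,\ a\ge 1,\ b\ge 0\}$. *)

theory Defs
  imports "HOL-Computational_Algebra.Primes" "HOL-Number_Theory.Cong"
begin

text \<open>The elements are taken in the type of integers, so that subtraction is not truncated;
  the exponents are nonnegative in the source and hence natural numbers.\<close>

definition principal_skeleton :: "int set" where
  "principal_skeleton = {2 ^ a * 3 ^ b - 1 | a b :: nat. a \<ge> 1 \<and> b \<ge> 0}"

definition skeleton_row :: "nat \<Rightarrow> int set" where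
  "skeleton_row k = {2 ^ a * 3 ^ b - 1 | a b :: nat. a + b = k \<and> a \<ge> 1 \<and> b \<ge> 0}"

lemma skeleton_row_subset: "skeleton_row k \<subseteq> principal_skeleton"
  unfolding skeleton_row_def principal_skeleton_def by blast

end

theory Submission
  imports Defs
begin

text \<open>An element of the row is \<open>2 ^ a * 3 ^ b - 1\<close> with \<open>a + b = k\<close>. Since \<open>k\<close> is even, \<open>a\<close> and
  \<open>b\<close> have the same parity. If both are even, then \<open>2 ^ a * 3 ^ b\<close> is a square \<open>x\<^sup>2\<close> and
  \<open>x\<^sup>2 - 1 = (x - 1) * (x + 1)\<close> factors properly. If both are odd, then \<open>5\<close> divides the element:
  modulo 5 we have \<open>3 = 2 ^ 3\<close>, so \<open>2 ^ a * 3 ^ b\<close> is \<open>2 ^ (a + 3 * b) = 2 ^ (k + 2 * b)\<close>, whose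
  exponent is divisible by 4 because \<open>k\<close> and \<open>2 * b\<close> are both 2 modulo 4; and \<open>2 ^ 4\<close> is 1
  modulo 5. The bound \<open>k \<ge> 6\<close> makes the elements large enough for both factorizations to be
  proper (for \<open>k = 2\<close> the row is \<open>{3, 5}\<close>).\<close>

lemma not_prime_square_minus_one:
  fixes x :: int
  assumes "x > 2"
  shows "\<not> prime (x\<^sup>2 - 1)"
proof -
  have "x\<^sup>2 - 1 = (x - 1) * (x + 1)"
    by (simp add: power2_eq_square algebra_simps)
  moreover have "\<not> is_unit (x - 1)" "\<not> is_unit (x + 1)"
    using assms by auto
  ultimately show ?thesis
    by (metis irreducible_multD prime_elem_imp_irreducible prime_imp_prime_elem)
qed

lemma power_sum_le_power_two_three: "2 ^ (a + b) \<le> (2 ^ a * 3 ^ b :: int)"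
  by (simp add: power_add power_mono)

lemma five_dvd_power_two_three_minus_one:
  fixes a b :: nat
  assumes "4 dvd a + 3 * b"
  shows "5 dvd (2 ^ a * 3 ^ b - 1 :: int)"
proof -
  from assms obtain m where m: "a + 3 * b = 4 * m" ..
  have "[3 ^ b = (2 ^ 3) ^ b] (mod (5 :: int))"
    by (intro cong_pow) (simp add: cong_def)
  then have "[2 ^ a * 3 ^ b = 2 ^ a * (2 ^ 3) ^ b] (mod (5 :: int))"
    by (rule cong_scalar_left)
  also have "(2 ^ a * (2 ^ 3) ^ b :: int) = (2 ^ 4) ^ m"
    by (simp only: m flip: power_mult power_add)
  also have "[(2 ^ 4) ^ m = 1 ^ m] (mod (5 :: int))"
    by (intro cong_pow) (simp add: cong_def)
  finally show ?thesis
    by (simp add: cong_iff_dvd_diff)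
qed

theorem theorem4p1:
  fixes k :: nat
  assumes "k \<ge> 6" and "[k = 2] (mod 4)"
  shows "\<forall>p \<in> skeleton_row k. \<not> prime p"
proof
  fix p
  assume "p \<in> skeleton_row k"
  then obtain a b :: nat where p: "p = 2 ^ a * 3 ^ b - 1" and ab: "a + b = k"
    unfolding skeleton_row_def by blast
  have k4: "k mod 4 = 2"
    using assms(2) by (simp add: cong_def)
  show "\<not> prime p"
  proof (cases "even b")
    case True
    moreover from this have "even a"
      using ab k4 by presburger
    ultimately obtain i j where i: "a = 2 * i" and j: "b = 2 * j"
      by (auto elim!: evenE)
    have "(2 :: int) ^ 3 \<le> 2 ^ (i + j)"
      using assms(1) ab i j by (intro power_increasing) auto
    also have "\<dots> \<le> 2 ^ i * 3 ^ j"
      by (rule power_sum_le_power_two_three)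
    finally have "\<not> prime ((2 ^ i * 3 ^ j)\<^sup>2 - 1 :: int)"
      by (intro not_prime_square_minus_one) simp
    then show ?thesis
      by (simp add: p i j power_mult_distrib mult.commute flip: power_mult)
  next
    case False
    then have "4 dvd a + 3 * b"
      using ab k4 by presburger
    then have "5 dvd p"
      unfolding p by (rule five_dvd_power_two_three_minus_one)
    moreover have "p \<noteq> 5"
    proof -
      have "(2 :: int) ^ 6 \<le> 2 ^ (a + b)"
        using assms(1) ab by (intro power_increasing) auto
      then show ?thesis
        using power_sum_le_power_two_three[of a b] by (simp add: p)
    qed
    ultimately show ?thesis
      using primes_dvd_imp_eq[of 5 p] by auto
  qed
qed

end
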